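(* Let $n\ge 1$ and $p\in[0,1]$. To every locally $p$-biased function $f:\{0,1\}^n\to \{-1,1\}$ on the hypercube one can assign a locally $p$-biased function $\tilde{f}:\mathbb{Z}^n\to \{-1,1\}$ extending it, i.e. $\tilde f\big|_{\{0,1\}^n}=f$, in such a way that if $f$ and $g$ are non-isomorphic locally $p$-biased functions on the hypercube, then $\tilde{f}$ and $\tilde{g}$ are non-isomorphic.
   Context: The $n$-dimensional hypercube is identified with the subset $\{0,1\}^n\subset\mathbb{Z}^n$, as a graph in which two vertices are adjacent iff they differ in exactly one coordinate. $\mathbb{Z}^n$ is the standard lattice graph ($x\sim y$ iff $x-y=\pm e_i$ for some standard basis vector $e_i$). For a regular graph $G$ of finite degree $d$, a function $f:G\to\{-1,1\}$ is locally $p$-biased if for every vertex $x$, $|\{y\sim x : f(y)=1\}|/d = p$. Two functions $f,g:G\to\{-1,1\}$ on the same graph are isomorphic if there is a graph automorphism $\psi$ of $G$ with $f\circ\psi=g$, and non-isomorphic otherwise. *)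

theory Defs
  imports "HOL-Analysis.Finite_Cartesian_Product" "HOL-Library.FuncSet"
begin

record 'a sgraph =
  verts :: "'a set"
  adj :: "'a \<Rightarrow> 'a \<Rightarrow> bool"

definition nbrs :: "'a sgraph \<Rightarrow> 'a \<Rightarrow> 'a set" where
  "nbrs G x = {y \<in> verts G. adj G x y}"

definition regular :: "'a sgraph \<Rightarrow> nat \<Rightarrow> bool" where
  "regular G d \<longleftrightarrow> (\<forall>x\<in>verts G. finite (nbrs G x) \<and> card (nbrs G x) = d)"

text \<open>A function on the vertex set is represented extensionally, so that equality of two
  such functions means agreement on the vertices.\<close>

definition locally_biased :: "'a sgraph \<Rightarrow> real \<Rightarrow> ('a \<Rightarrow> int) \<Rightarrow> bool" where
  "locally_biased G p f \<longleftrightarrow>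
     f \<in> verts G \<rightarrow>\<^sub>E {-1, 1} \<and>
     (\<exists>d. regular G d \<and>
        (\<forall>x\<in>verts G. real (card {y \<in> nbrs G x. f y = 1}) / real d = p))"

definition automorphism :: "'a sgraph \<Rightarrow> ('a \<Rightarrow> 'a) \<Rightarrow> bool" where
  "automorphism G \<psi> \<longleftrightarrow>
     bij_betw \<psi> (verts G) (verts G) \<and>
     (\<forall>x\<in>verts G. \<forall>y\<in>verts G. adj G (\<psi> x) (\<psi> y) \<longleftrightarrow> adj G x y)"

definition isomorphic_funs :: "'a sgraph \<Rightarrow> ('a \<Rightarrow> 'b) \<Rightarrow> ('a \<Rightarrow> 'b) \<Rightarrow> bool" where
  "isomorphic_funs G f g \<longleftrightarrow> (\<exists>\<psi>. automorphism G \<psi> \<and> (\<forall>x\<in>verts G. f (\<psi> x) = g x))"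

text \<open>The dimension \<open>n\<close> is \<open>CARD('n)\<close>, which is at least 1 for every finite type.\<close>

definition hypercube :: "(int ^ 'n) sgraph" where
  "hypercube = \<lparr> verts = {x. \<forall>i. x $ i \<in> {0, 1}},
                 adj = (\<lambda>x y. \<exists>!i. x $ i \<noteq> y $ i) \<rparr>"

definition int_lattice :: "(int ^ 'n) sgraph" where
  "int_lattice = \<lparr> verts = UNIV,
                   adj = (\<lambda>x y. \<exists>i. x - y = axis i 1 \<or> x - y = - axis i 1) \<rparr>"

end

theory Submission
  imports Defs
begin

text \<open>The extension of \<open>f\<close> is \<open>f\<close> composed with reduction modulo 2. Reduction modulo 2 is a covering of
  the hypercube by the lattice in which every edge at a vertex of the cube has exactly two lifts at
  each point above that vertex: stepping forwards and stepping backwards along a coordinate have the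
  same parity. Hence every count of neighbours doubles, the degree included, and the proportion \<open>p\<close>
  is unchanged (\<open>card_lattice_nbrs\<close>).

  For the second half it suffices that every automorphism \<open>\<psi>\<close> of the lattice descends to an
  automorphism of the hypercube, since an isomorphism between two extensions then induces one
  between the original functions. The congruence classes modulo 2 can be recognised from the graph:
  two points have exactly one common neighbour only if they are congruent modulo 2, and all pairs
  \<open>x\<close>, \<open>x + 2e\<^sub>i\<close> are of this kind. The property of having exactly one common neighbour is invariant
  under \<open>\<psi>\<close>, and the pairs \<open>x\<close>, \<open>x + 2e\<^sub>i\<close> generate congruence modulo 2; so \<open>\<psi>\<close> permutes the
  congruence classes (\<open>parity_lattice_automorphism_iff\<close>), which are the vertices of the
  hypercube.\<close>

section \<open>Parity and unit steps\<close>

definition parity :: "int ^ 'n \<Rightarrow> int ^ 'n" where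
  "parity x = (\<chi> i. x $ i mod 2)"

lemma parity_nth [simp]: "parity x $ i = x $ i mod 2"
  by (simp add: parity_def)

lemma parity_eq_iff: "parity x = parity y \<longleftrightarrow> (\<forall>i. x $ i mod 2 = y $ i mod 2)"
  by (simp add: vec_eq_iff)

lemma parity_in_hypercube [simp]: "parity x \<in> verts hypercube"
  by (auto simp: hypercube_def)

lemma parity_hypercube:
  assumes "x \<in> verts hypercube"
  shows "parity x = x"
proof -
  have "x $ i = 0 \<or> x $ i = 1" for i
    using assms by (simp add: hypercube_def)
  then have "x $ i mod 2 = x $ i" for i
    by (metis mod_0 one_mod_two_eq_one)
  then show ?thesis by (simp add: vec_eq_iff)
qed

lemma finite_hypercube: "finite (verts (hypercube :: (int ^ 'n) sgraph))"
proof -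
  have "verts (hypercube :: (int ^ 'n) sgraph) \<subseteq> vec_lambda ` (UNIV \<rightarrow>\<^sub>E {0, 1})"
  proof
    fix x :: "int ^ 'n" assume "x \<in> verts hypercube"
    then show "x \<in> vec_lambda ` (UNIV \<rightarrow>\<^sub>E {0, 1})"
      by (intro image_eqI[of _ _ "vec_nth x"]) (auto simp: hypercube_def)
  qed
  then show ?thesis
    by (rule finite_subset) (simp add: finite_PiE)
qed

lemma verts_lattice [simp]: "verts int_lattice = UNIV"
  by (simp add: int_lattice_def)

lemma adj_hypercube: "adj hypercube x y \<longleftrightarrow> (\<exists>!i. x $ i \<noteq> y $ i)"
  by (simp add: hypercube_def)

definition unit_step :: "int ^ 'n \<Rightarrow> bool" where
  "unit_step a \<longleftrightarrow> (\<exists>i. a = axis i 1 \<or> a = - axis i 1)"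

lemma adj_lattice: "adj int_lattice x y \<longleftrightarrow> unit_step (x - y)"
  by (simp add: int_lattice_def unit_step_def)

lemma unit_step_minus [simp]: "unit_step (- a) \<longleftrightarrow> unit_step a"
  unfolding unit_step_def by (metis minus_minus)

lemma unit_step_axis [simp]: "unit_step (axis i 1)"
  by (auto simp: unit_step_def)

lemma unit_step_nth_le: "unit_step a \<Longrightarrow> \<bar>a $ i\<bar> \<le> 1"
  by (auto simp: unit_step_def axis_def)

lemma unit_step_eq_axis: "unit_step a \<Longrightarrow> a $ i = 1 \<Longrightarrow> a = axis i 1"
  by (auto simp: unit_step_def axis_def split: if_splits)

section \<open>Reduction modulo 2 as a covering\<close>

lemma adj_hypercube_parity_add_axis:
  "adj hypercube (parity x) (parity (x + axis i 1))"
  unfolding adj_hypercube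
proof (rule ex1I[of _ i])
  show "parity x $ i \<noteq> parity (x + axis i 1) $ i"
    by (simp add: axis_def) presburger
  show "j = i" if "parity x $ j \<noteq> parity (x + axis i 1) $ j" for j
    using that by (cases "j = i") (simp_all add: axis_def)
qed

lemma parity_diff_axis: "parity (x - axis i 1) = parity (x + axis i 1)"
  by (auto simp: parity_eq_iff axis_def) presburger

lemma adj_hypercube_parity_lift:
  assumes "adj hypercube (parity x) (parity y)"
  shows "\<exists>i. parity y = parity (x + axis i 1)"
proof -
  obtain i where i: "x $ i mod 2 \<noteq> y $ i mod 2" "\<And>j. x $ j mod 2 \<noteq> y $ j mod 2 \<Longrightarrow> j = i"
    using assms by (auto simp: adj_hypercube)
  have "y $ j mod 2 = (x + axis i 1) $ j mod 2" for j
  proof (cases "j = i")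
    case True
    then show ?thesis using i(1) by (simp add: axis_def) presburger
  next
    case False
    then show ?thesis using i(2)[of j] by (simp add: axis_def) metis
  qed
  then show ?thesis by (auto simp: parity_eq_iff)
qed

lemma adj_lattice_imp_adj_parity:
  assumes "adj int_lattice x y"
  shows "adj hypercube (parity x) (parity y)"
proof -
  obtain i where "y = x - axis i 1 \<or> y = x + axis i 1"
    using assms by (force simp: int_lattice_def algebra_simps)
  then show ?thesis
    using adj_hypercube_parity_add_axis[of x i] by (auto simp: parity_diff_axis)
qed

text \<open>Both sides are governed by the set of those coordinates \<open>i\<close> for which changing the parity of
  \<open>x\<^sub>i\<close> leads into \<open>A\<close>; such a coordinate accounts for one neighbour in the cube and for the
  two neighbours \<open>x \<plusminus> e\<^sub>i\<close> in the lattice. With \<open>A = UNIV\<close> this compares the degrees, and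
  in general it compares the numbers of neighbours at which a function takes a given value.\<close>

lemma card_lattice_nbrs:
  fixes x :: "int ^ 'n"
  shows "finite (nbrs int_lattice x)"
    and "card {y \<in> nbrs int_lattice x. parity y \<in> A} =
           2 * card {v \<in> nbrs hypercube (parity x). v \<in> A}"
proof -
  define up where "up i = x + axis i 1" for i :: 'n
  define down where "down i = x - axis i 1" for i :: 'n
  have down_up: "parity (down i) = parity (up i)" for i
    by (simp add: up_def down_def parity_diff_axis)
  have nbrs: "nbrs int_lattice x = range up \<union> range down"
    by (force simp: nbrs_def int_lattice_def up_def down_def algebra_simps)
  then show "finite (nbrs int_lattice x)" by simp
  define J where "J = {i. parity (up i) \<in> A}"
  have lattice: "{y \<in> nbrs int_lattice x. parity y \<in> A} = up ` J \<union> down ` J"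
    by (auto simp: nbrs J_def down_up)
  have cube: "{v \<in> nbrs hypercube (parity x). v \<in> A} = (\<lambda>i. parity (up i)) ` J"
  proof
    show "(\<lambda>i. parity (up i)) ` J \<subseteq> {v \<in> nbrs hypercube (parity x). v \<in> A}"
      by (auto simp: nbrs_def J_def up_def adj_hypercube_parity_add_axis)
    show "{v \<in> nbrs hypercube (parity x). v \<in> A} \<subseteq> (\<lambda>i. parity (up i)) ` J"
    proof
      fix v assume v: "v \<in> {v \<in> nbrs hypercube (parity x). v \<in> A}"
      then have "parity v = v" by (auto simp: nbrs_def parity_hypercube)
      with v obtain i where "v = parity (up i)"
        using adj_hypercube_parity_lift[of x v] by (auto simp: nbrs_def up_def)
      with v show "v \<in> (\<lambda>i. parity (up i)) ` J" by (auto simp: J_def)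
    qed
  qed
  have inj_parity: "inj (\<lambda>i. parity (up i))"
  proof (rule injI)
    fix i j assume "parity (up i) = parity (up j)"
    then have "(x + axis i 1) $ i mod 2 = (x + axis j 1) $ i mod 2"
      unfolding up_def parity_eq_iff by blast
    then show "i = j" by (simp add: axis_def split: if_splits) presburger
  qed
  have inj_up: "inj up"
    by (rule injI, rule injD[OF inj_parity]) simp
  have inj_down: "inj down"
    by (rule injI, rule injD[OF inj_parity]) (simp flip: down_up)
  have disjoint: "up ` J \<inter> down ` J = {}"
  proof -
    have "up i \<noteq> down j" for i j
    proof
      assume "up i = down j"
      then have "(x + axis i 1) $ i = (x - axis j 1) $ i" by (simp add: up_def down_def)
      then show False by (auto simp: axis_def split: if_splits)
    qed
    then show ?thesis by auto
  qed
  have "card {y \<in> nbrs int_lattice x. parity y \<in> A} = card (up ` J) + card (down ` J)"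
    unfolding lattice by (rule card_Un_disjoint) (auto simp: disjoint)
  also have "\<dots> = 2 * card ((\<lambda>i. parity (up i)) ` J)"
    using inj_up inj_down inj_parity by (simp add: card_image inj_on_subset)
  finally show "card {y \<in> nbrs int_lattice x. parity y \<in> A} =
      2 * card {v \<in> nbrs hypercube (parity x). v \<in> A}"
    by (simp add: cube)
qed

lemma locally_biased_comp_parity:
  fixes f :: "int ^ 'n \<Rightarrow> int"
  assumes "locally_biased hypercube p f"
  shows "locally_biased int_lattice p (\<lambda>x. f (parity x))"
proof -
  obtain d where f: "f \<in> verts hypercube \<rightarrow>\<^sub>E {-1, 1}"
    and reg: "regular (hypercube :: (int ^ 'n) sgraph) d"
    and bias: "\<And>v. v \<in> verts hypercube \<Longrightarrow>
      real (card {y \<in> nbrs hypercube v. f y = 1}) / real d = p"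
    using assms by (auto simp: locally_biased_def)
  have "regular (int_lattice :: (int ^ 'n) sgraph) (2 * d)"
  proof -
    have "card (nbrs int_lattice x) = 2 * d" for x :: "int ^ 'n"
      using card_lattice_nbrs(2)[of x UNIV] reg by (simp add: regular_def)
    then show ?thesis by (simp add: regular_def card_lattice_nbrs(1))
  qed
  moreover have "real (card {y \<in> nbrs int_lattice x. f (parity y) = 1}) / real (2 * d) = p" for x
    using card_lattice_nbrs(2)[of x "{v. f v = 1}"] bias[of "parity x"] by simp
  moreover have "(\<lambda>x. f (parity x)) \<in> verts int_lattice \<rightarrow>\<^sub>E {-1, 1}"
    using PiE_mem[OF f parity_in_hypercube] by (simp add: PiE_UNIV_domain)
  ultimately show ?thesis by (auto simp: locally_biased_def)
qed

section \<open>Lattice automorphisms descend to the hypercube\<close>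

definition unique_common_nbr :: "int ^ 'n \<Rightarrow> int ^ 'n \<Rightarrow> bool" where
  "unique_common_nbr x y \<longleftrightarrow> (\<exists>!z. adj int_lattice x z \<and> adj int_lattice y z)"

text \<open>A common neighbour \<open>z\<close> of \<open>x\<close> and \<open>y\<close> has the mirror image \<open>x + y - z\<close>, the opposite corner
  of a parallelogram, which is again a common neighbour. If the two coincide then \<open>x + y = 2z\<close>.\<close>

lemma unique_common_nbr_imp_parity_eq:
  assumes "unique_common_nbr x y"
  shows "parity x = parity y"
proof -
  obtain z where z: "adj int_lattice x z" "adj int_lattice y z"
    and uniq: "\<And>w. adj int_lattice x w \<Longrightarrow> adj int_lattice y w \<Longrightarrow> w = z"
    using assms by (auto simp: unique_common_nbr_def)
  have "unit_step (z - y)" "unit_step (z - x)"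
    using z unit_step_minus[of "y - z"] unit_step_minus[of "x - z"] by (simp_all add: adj_lattice)
  then have "x + y - z = z"
    by (intro uniq) (simp_all add: adj_lattice)
  then have "x $ i + y $ i = 2 * z $ i" for i
    by (metis diff_add_cancel mult_2 vector_add_component)
  then have "x $ i = y $ i + 2 * (z $ i - y $ i)" for i
    by (simp add: algebra_simps)
  then have "x $ i mod 2 = y $ i mod 2" for i
    by (metis mod_mult_self2)
  then show ?thesis by (simp add: parity_eq_iff)
qed

lemma unique_common_nbr_add_axis:
  fixes x :: "int ^ 'n"
  shows "unique_common_nbr x (x + axis i 2)"
proof -
  have two: "axis i 2 = axis i 1 + (axis i 1 :: int ^ 'n)"
    by (simp add: vec_eq_iff axis_def)
  show ?thesis
    unfolding unique_common_nbr_def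
  proof (rule ex1I[of _ "x + axis i 1"])
    show "adj int_lattice x (x + axis i 1) \<and> adj int_lattice (x + axis i 2) (x + axis i 1)"
      by (simp add: adj_lattice two)
  next
    fix z assume "adj int_lattice x z \<and> adj int_lattice (x + axis i 2) z"
    then have steps: "unit_step (z - x)" "unit_step (x + axis i 2 - z)"
      using unit_step_minus[of "x - z"] by (auto simp: adj_lattice)
    \<comment> \<open>The two steps add up to \<open>2\<close> in coordinate \<open>i\<close> and contribute at most \<open>1\<close> each.\<close>
    have "(z - x) $ i = 1"
      using unit_step_nth_le[OF steps(1), of i] unit_step_nth_le[OF steps(2), of i]
      by (simp add: axis_def)
    with steps(1) have "z - x = axis i 1" by (rule unit_step_eq_axis)
    then show "z = x + axis i 1" by (simp add: algebra_simps)
  qed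
qed

lemma unique_common_nbr_automorphism:
  assumes "automorphism int_lattice \<psi>" and "unique_common_nbr x y"
  shows "unique_common_nbr (\<psi> x) (\<psi> y)"
proof -
  have "surj \<psi>" and adj: "\<And>x y. adj int_lattice (\<psi> x) (\<psi> y) \<longleftrightarrow> adj int_lattice x y"
    using assms(1) by (auto simp: automorphism_def bij_betw_def)
  then show ?thesis
    using assms(2) unfolding unique_common_nbr_def by (metis surjD)
qed

text \<open>The vectors \<open>k\<close> for which \<open>\<psi> (x + k)\<close> always has the parity of \<open>\<psi> x\<close> form a group. It contains all \<open>2e\<^sub>i\<close> by the
  invariance of unique common neighbours, hence every even vector.\<close>

lemma parity_lattice_automorphism:
  fixes \<psi> :: "int ^ 'n \<Rightarrow> int ^ 'n"
  assumes \<psi>: "automorphism int_lattice \<psi>" and "parity x = parity y"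
  shows "parity (\<psi> x) = parity (\<psi> y)"
proof -
  define P where "P k \<longleftrightarrow> (\<forall>x. parity (\<psi> (x + k)) = parity (\<psi> x))" for k
  have add: "P (k + l)" if "P k" "P l" for k l
    using that unfolding P_def by (metis add.assoc)
  have diff: "P (k - l)" if "P k" "P l" for k l
    using that unfolding P_def by (metis diff_add_eq diff_add_cancel add_diff_eq)
  have zero: "P 0"
    by (simp add: P_def)
  have gen: "P (axis i 2)" for i
    unfolding P_def
    using unique_common_nbr_imp_parity_eq[OF unique_common_nbr_automorphism[OF \<psi>]]
      unique_common_nbr_add_axis by metis
  have axis: "P (axis i (2 * m))" for i m
  proof (induction m rule: int_induct[of _ 0])
    case base
    then show ?case using zero by (simp add: axis_def zero_vec_def)
  next
    case (step1 m)
    have "axis i (2 * (m + 1)) = axis i (2 * m) + (axis i 2 :: int ^ 'n)"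
      by (simp add: vec_eq_iff axis_def)
    then show ?case using add[OF step1(2) gen] by simp
  next
    case (step2 m)
    have "axis i (2 * (m - 1)) = axis i (2 * m) - (axis i 2 :: int ^ 'n)"
      by (simp add: vec_eq_iff axis_def)
    then show ?case using diff[OF step2(2) gen] by simp
  qed
  have sum: "P (\<Sum>i\<in>I. axis i (2 * c i))" if "finite I" for I c
    using that by (induction I rule: finite_induct) (simp_all add: zero add axis)
  have "\<forall>i. \<exists>m. y $ i - x $ i = 2 * m"
    using assms(2) by (auto simp: parity_eq_iff) (metis dvdE mod_eq_dvd_iff)
  then obtain c where c: "\<And>i. y $ i - x $ i = 2 * c i"
    by metis
  have "y = x + (\<Sum>i\<in>UNIV. axis i (2 * c i))"
    by (simp add: vec_eq_iff axis_def flip: c)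
  then show ?thesis
    using sum[OF finite, of c] by (simp add: P_def)
qed

lemma automorphism_inv_lattice:
  assumes "automorphism int_lattice \<psi>"
  shows "automorphism int_lattice (inv \<psi>)"
proof -
  have "bij \<psi>" and adj: "\<And>x y. adj int_lattice (\<psi> x) (\<psi> y) \<longleftrightarrow> adj int_lattice x y"
    using assms by (auto simp: automorphism_def)
  then have "adj int_lattice (inv \<psi> x) (inv \<psi> y) \<longleftrightarrow> adj int_lattice x y" for x y
    using adj[of "inv \<psi> x" "inv \<psi> y"] by (simp add: bij_is_surj surj_f_inv_f)
  with \<open>bij \<psi>\<close> show ?thesis
    by (simp add: automorphism_def bij_imp_bij_inv)
qed

lemma parity_lattice_automorphism_iff:
  assumes "automorphism int_lattice \<psi>"
  shows "parity (\<psi> x) = parity (\<psi> y) \<longleftrightarrow> parity x = parity y"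
proof
  have inv: "inv \<psi> (\<psi> z) = z" for z
    using assms by (simp add: automorphism_def bij_is_inj)
  assume "parity (\<psi> x) = parity (\<psi> y)"
  from parity_lattice_automorphism[OF automorphism_inv_lattice[OF assms] this]
  show "parity x = parity y"
    unfolding inv .
next
  assume "parity x = parity y"
  then show "parity (\<psi> x) = parity (\<psi> y)"
    by (rule parity_lattice_automorphism[OF assms])
qed

lemma automorphism_hypercube_parity:
  fixes \<psi> :: "int ^ 'n \<Rightarrow> int ^ 'n"
  assumes \<psi>: "automorphism int_lattice \<psi>"
  shows "automorphism hypercube (\<lambda>x. parity (\<psi> x))"
proof -
  let ?Q = "verts (hypercube :: (int ^ 'n) sgraph)"
  have adj\<psi>: "\<And>x y. adj int_lattice (\<psi> x) (\<psi> y) \<longleftrightarrow> adj int_lattice x y" and "surj \<psi>"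
    using \<psi> by (auto simp: automorphism_def bij_betw_def)
  have "inj_on (\<lambda>x. parity (\<psi> x)) ?Q"
    by (auto simp: inj_on_def parity_lattice_automorphism_iff[OF \<psi>] parity_hypercube)
  then have "(\<lambda>x. parity (\<psi> x)) ` ?Q = ?Q"
    by (intro endo_inj_surj finite_hypercube) auto
  with \<open>inj_on _ ?Q\<close> have "bij_betw (\<lambda>x. parity (\<psi> x)) ?Q ?Q"
    by (simp add: bij_betw_def)
  moreover have "adj hypercube (parity (\<psi> x)) (parity (\<psi> y)) \<longleftrightarrow> adj hypercube x y"
    if x: "x \<in> ?Q" and y: "y \<in> ?Q" for x y
  proof
    assume "adj hypercube x y"
    then obtain i where i: "parity y = parity (x + axis i 1)"
      using x y adj_hypercube_parity_lift[of x y] by (auto simp: parity_hypercube)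
    have "adj int_lattice x (x + axis i 1)"
      by (simp add: adj_lattice)
    then have "adj hypercube (parity (\<psi> x)) (parity (\<psi> (x + axis i 1)))"
      by (intro adj_lattice_imp_adj_parity) (simp add: adj\<psi>)
    then show "adj hypercube (parity (\<psi> x)) (parity (\<psi> y))"
      using i parity_lattice_automorphism[OF \<psi>] by metis
  next
    \<comment> \<open>The edge is lifted to an edge at \<open>\<psi> x\<close>, pulled back along \<open>\<psi>\<close> and projected again. The other
      end of the lift need not be \<open>\<psi> y\<close>, but it has the same parity.\<close>
    assume "adj hypercube (parity (\<psi> x)) (parity (\<psi> y))"
    then obtain i where i: "parity (\<psi> y) = parity (\<psi> x + axis i 1)"
      using adj_hypercube_parity_lift by blast
    obtain z where z: "\<psi> z = \<psi> x + axis i 1"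
      using \<open>surj \<psi>\<close> by (metis surjD)
    have "adj int_lattice (\<psi> x) (\<psi> z)"
      by (simp add: adj_lattice z)
    then have "adj hypercube (parity x) (parity z)"
      by (intro adj_lattice_imp_adj_parity) (simp add: adj\<psi>)
    moreover have "parity z = parity y"
      using i z parity_lattice_automorphism_iff[OF \<psi>] by metis
    ultimately show "adj hypercube x y"
      using x y by (simp add: parity_hypercube)
  qed
  ultimately show ?thesis by (simp add: automorphism_def)
qed

lemma isomorphic_hypercube_of_comp_parity:
  assumes "isomorphic_funs int_lattice (\<lambda>x. f (parity x)) (\<lambda>x. g (parity x))"
  shows "isomorphic_funs hypercube f g"
proof -
  obtain \<psi> where \<psi>: "automorphism int_lattice \<psi>" and eq: "\<And>x. f (parity (\<psi> x)) = g (parity x)"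
    using assms by (auto simp: isomorphic_funs_def)
  have "\<forall>x\<in>verts hypercube. f (parity (\<psi> x)) = g x"
    using eq by (simp add: parity_hypercube)
  with automorphism_hypercube_parity[OF \<psi>] show ?thesis
    unfolding isomorphic_funs_def by blast
qed

section \<open>Extension by parity\<close>

lemma restrict_comp_parity:
  assumes "f \<in> extensional (verts hypercube)"
  shows "restrict (\<lambda>x. f (parity x)) (verts hypercube) = f"
proof (rule extensionalityI[OF restrict_extensional assms])
  show "restrict (\<lambda>x. f (parity x)) (verts hypercube) v = f v" if "v \<in> verts hypercube" for v
    using that by (simp add: parity_hypercube)
qed

theorem proposition5p5:
  fixes p :: real
  assumes "0 \<le> p" and "p \<le> 1"
  shows "\<exists>ext :: (int ^ 'n \<Rightarrow> int) \<Rightarrow> (int ^ 'n \<Rightarrow> int).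
    (\<forall>f. locally_biased hypercube p f \<longrightarrow>
        locally_biased int_lattice p (ext f) \<and>
        restrict (ext f) (verts (hypercube :: (int ^ 'n) sgraph)) = f) \<and>
    (\<forall>f g. locally_biased hypercube p f \<longrightarrow> locally_biased hypercube p g \<longrightarrow>
        \<not> isomorphic_funs hypercube f g \<longrightarrow>
        \<not> isomorphic_funs int_lattice (ext f) (ext g))"
proof (intro exI[of _ "\<lambda>f x. f (parity x)"] conjI allI impI)
  fix f :: "int ^ 'n \<Rightarrow> int" assume f: "locally_biased hypercube p f"
  then show "locally_biased int_lattice p (\<lambda>x. f (parity x))"
    by (rule locally_biased_comp_parity)
  have "f \<in> extensional (verts hypercube)"
    using f by (simp add: locally_biased_def PiE_def)
  then show "restrict (\<lambda>x. f (parity x)) (verts hypercube) = f"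
    by (rule restrict_comp_parity)
next
  fix f g :: "int ^ 'n \<Rightarrow> int" assume "\<not> isomorphic_funs hypercube f g"
  then show "\<not> isomorphic_funs int_lattice (\<lambda>x. f (parity x)) (\<lambda>x. g (parity x))"
    using isomorphic_hypercube_of_comp_parity by blast
qed

end
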